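(* Let $B=B^*$. The system of root functions of the boundary value problem $$-iBy'=\lambda y,\quad y=\operatorname{col}(y_1,\dots,y_n),\qquad Cy(0)+Dy(1)=0,$$ is incomplete in $L^2([0,1];\mathbb{C}^n)$ whenever $\det(CP_-+DP_+)=0$. Moreover, in this case its defect is infinite.
   Context: $B=\operatorname{diag}(b_1^{-1}I_{n_1},\dots,b_r^{-1}I_{n_r})\in\mathbb{C}^{n\times n}$, $n=n_1+\dots+n_r$, is a nonsingular diagonal matrix, $b_j\neq b_k$ for $j\neq k$ (real entries when $B=B^*$). $C,D\in\mathbb{C}^{n\times n}$ satisfy $\operatorname{rank}(C\ D)=n$. $P_+$ and $P_-$ are the spectral projectors of $B$ onto the positive and negative parts of its spectrum. The problem is identified with the operator $L_{C,D}(0)$ in $L^2([0,1];\mathbb{C}^n)$ acting by $Ly=-iBy'$ on $\{y\in W^1_2([0,1];\mathbb{C}^n): Cy(0)+Dy(1)=0\}$. Root functions are eigenfunctions and associated functions, i.e. the system of root functions is the union, over all eigenvalues $\lambda$, of bases of the root subspaces $\operatorname{span}\{\ker(L_{C,D}(0)-\lambda)^k: k\in\mathbb{N}\}$. A system is complete if its closed linear span is the whole space; its defect is the dimension of the orthogonal complement of its closed linear span. *)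

theory Defs
  imports "HOL-Analysis.Analysis" "HOL-Library.Extended_Nat"
begin

section \<open>The Hilbert space of square-integrable vector functions on the unit interval\<close>

definition sq_integrable :: "(real \<Rightarrow> complex^'n) \<Rightarrow> bool" where
  "sq_integrable f \<longleftrightarrow> f \<in> borel_measurable (lebesgue_on {0..1}) \<and>
     integrable (lebesgue_on {0..1}) (\<lambda>x. (norm (f x))\<^sup>2)"

definition cdot :: "complex^'n \<Rightarrow> complex^'n \<Rightarrow> complex" where
  "cdot v w = (\<Sum>i\<in>UNIV. v $ i * cnj (w $ i))"

lemma norm_cdot_le: "norm (cdot v w) \<le> norm v * norm w"
proof -
  have "norm (cdot v w) \<le> (\<Sum>i\<in>UNIV. norm (v $ i) * norm (w $ i))"
    unfolding cdot_def by (rule order_trans[OF norm_sum]) (simp add: norm_mult)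
  also have "\<dots> \<le> norm v * norm w"
    unfolding norm_vec_def using L2_set_mult_ineq[of "\<lambda>i. norm (v $ i)" "\<lambda>i. norm (w $ i)" UNIV]
    by simp
  finally show ?thesis .
qed

lemma cdot_self: "cdot v v = of_real ((norm v)\<^sup>2)"
  unfolding cdot_def norm_vec_def L2_set_def
  by (simp add: sum_nonneg complex_norm_square del: of_real_power) 

lemma cdot_add_left: "cdot (u + v) w = cdot u w + cdot v w"
  by (simp add: cdot_def algebra_simps sum.distrib)

lemma cdot_scale_left: "cdot (c *s v) w = c * cdot v w"
  by (simp add: cdot_def algebra_simps sum_distrib_left)

lemma cdot_commute: "cdot w v = cnj (cdot v w)"
  by (simp add: cdot_def mult.commute)

lemma norm_cscale: "norm (c *s (v :: complex^'n)) = norm c * norm v"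
  unfolding norm_vec_def by (simp add: norm_mult L2_set_right_distrib)

lemma measurable_cscale [measurable]:
  assumes "f \<in> borel_measurable M"
  shows "(\<lambda>x. c *s (f x :: complex^'n)) \<in> borel_measurable M"
proof -
  have "continuous_on UNIV (\<lambda>v :: complex^'n. c *s v)"
    unfolding vector_scalar_mult_def by (intro continuous_intros)
  from borel_measurable_continuous_onI[OF this] assms show ?thesis
    by measurable
qed

lemma measurable_cdot [measurable]:
  assumes "f \<in> borel_measurable M" "g \<in> borel_measurable M"
  shows "(\<lambda>x. cdot (f x) (g x)) \<in> borel_measurable M"
proof -
  have *: "(\<lambda>v :: complex^'n. v $ i) \<in> borel_measurable borel" for i
    by (intro borel_measurable_continuous_onI continuous_intros)
  have "(\<lambda>x. f x $ i) \<in> borel_measurable M" "(\<lambda>x. g x $ i) \<in> borel_measurable M" for i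
    using measurable_compose[OF assms(1) *] measurable_compose[OF assms(2) *] by auto
  moreover have "cnj \<in> borel_measurable borel"
    by (intro borel_measurable_continuous_onI continuous_intros)
  ultimately show ?thesis unfolding cdot_def
    by (intro borel_measurable_sum borel_measurable_times) (auto intro: measurable_compose)
qed

lemma sq_integrable_zero: "sq_integrable (\<lambda>_. 0)"
  by (simp add: sq_integrable_def)

lemma sq_integrable_scale:
  assumes "sq_integrable f" shows "sq_integrable (\<lambda>x. c *s f x)"
  using assms unfolding sq_integrable_def by (auto simp: norm_cscale power_mult_distrib)

lemma sq_integrable_add:
  assumes "sq_integrable f" "sq_integrable g"
  shows "sq_integrable (\<lambda>x. f x + g x)"
proof -
  have [measurable]: "f \<in> borel_measurable (lebesgue_on {0..1})"
       "g \<in> borel_measurable (lebesgue_on {0..1})"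
    using assms by (auto simp: sq_integrable_def)
  have *: "(norm (v + w))\<^sup>2 \<le> 2 * (norm v)\<^sup>2 + 2 * (norm w)\<^sup>2" for v w :: "complex^'a"
  proof -
    have "(norm (v + w))\<^sup>2 \<le> (norm v + norm w)\<^sup>2"
      by (intro power_mono norm_triangle_ineq) auto
    also have "\<dots> \<le> 2 * (norm v)\<^sup>2 + 2 * (norm w)\<^sup>2"
      using sum_squares_bound[of "norm v" "norm w"] by (simp add: power2_sum)
    finally show ?thesis .
  qed
  have "integrable (lebesgue_on {0..1}) (\<lambda>x. 2 * (norm (f x))\<^sup>2 + 2 * (norm (g x))\<^sup>2)"
    using assms by (auto simp: sq_integrable_def)
  then have "integrable (lebesgue_on {0..1}) (\<lambda>x. (norm (f x + g x))\<^sup>2)"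
    by (elim Bochner_Integration.integrable_bound) (auto intro!: AE_I2 *)
  thus ?thesis by (simp add: sq_integrable_def)
qed

lemma integrable_cdot:
  assumes "sq_integrable f" "sq_integrable g"
  shows "integrable (lebesgue_on {0..1}) (\<lambda>x. cdot (f x) (g x))"
proof -
  have [measurable]: "f \<in> borel_measurable (lebesgue_on {0..1})"
       "g \<in> borel_measurable (lebesgue_on {0..1})"
    using assms by (auto simp: sq_integrable_def)
  have *: "norm (cdot v w) \<le> (norm v)\<^sup>2 + (norm w)\<^sup>2" for v w :: "complex^'a"
    using norm_cdot_le[of v w] sum_squares_bound[of "norm v" "norm w"]
      mult_nonneg_nonneg[OF norm_ge_zero norm_ge_zero, of v w] by linarith
  have "integrable (lebesgue_on {0..1}) (\<lambda>x. (norm (f x))\<^sup>2 + (norm (g x))\<^sup>2)"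
    using assms by (auto simp: sq_integrable_def)
  then show ?thesis
    by (rule Bochner_Integration.integrable_bound) (auto intro!: AE_I2 order_trans[OF *])
qed

definition L2_rel :: "(real \<Rightarrow> complex^'n) \<Rightarrow> (real \<Rightarrow> complex^'n) \<Rightarrow> bool" where
  "L2_rel f g \<longleftrightarrow> sq_integrable f \<and> sq_integrable g \<and> (AE x in lebesgue_on {0..1}. f x = g x)"

quotient_type 'n L2 = "real \<Rightarrow> complex^'n" / partial: L2_rel
  morphisms rep_L2 to_L2
proof (rule part_equivpI)
  show "\<exists>f :: real \<Rightarrow> complex^'n. L2_rel f f"
    by (rule exI[of _ "\<lambda>_. 0"]) (simp add: L2_rel_def sq_integrable_zero)
  show "symp (L2_rel :: (real \<Rightarrow> complex^'n) \<Rightarrow> _)"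
    by (rule sympI) (auto simp: L2_rel_def elim: eventually_mono)
  show "transp (L2_rel :: (real \<Rightarrow> complex^'n) \<Rightarrow> _)"
    by (rule transpI) (auto simp: L2_rel_def elim: eventually_elim2)
qed

lift_definition scaleC :: "complex \<Rightarrow> ('n::finite) L2 \<Rightarrow> 'n L2" is
  "\<lambda>(c :: complex) (f :: real \<Rightarrow> complex^'n) x. c *s f x"
  by (auto simp: L2_rel_def sq_integrable_scale)

lift_definition cinner :: "('n::finite) L2 \<Rightarrow> 'n L2 \<Rightarrow> complex" is
  "\<lambda>(f :: real \<Rightarrow> complex^'n) g. LINT x|lebesgue_on {0..1}. cdot (f x) (g x)"
proof -
  fix f f' g g' :: "real \<Rightarrow> complex^'n"
  assume 1: "L2_rel f f'" "L2_rel g g'"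
  hence "AE x in lebesgue_on {0..1}. cdot (f x) (g x) = cdot (f' x) (g' x)"
    by (auto simp: L2_rel_def elim: eventually_elim2)
  thus "(LINT x|lebesgue_on {0..1}. cdot (f x) (g x)) = (LINT x|lebesgue_on {0..1}. cdot (f' x) (g' x))"
    using 1 by (intro integral_cong_AE)
      (auto simp: L2_rel_def sq_integrable_def intro!: measurable_cdot)
qed

instantiation L2 :: (finite) real_inner
begin

lift_definition zero_L2 :: "'a L2" is "\<lambda>_. 0 :: complex^'a"
  by (simp add: L2_rel_def sq_integrable_zero)

lift_definition plus_L2 :: "'a L2 \<Rightarrow> 'a L2 \<Rightarrow> 'a L2" is
  "\<lambda>(f :: real \<Rightarrow> complex^'a) g x. f x + g x"
  by (auto simp: L2_rel_def sq_integrable_add elim: eventually_elim2)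

definition uminus_L2 :: "'a L2 \<Rightarrow> 'a L2" where "uminus_L2 f = scaleC (-1) f"

definition minus_L2 :: "'a L2 \<Rightarrow> 'a L2 \<Rightarrow> 'a L2" where "minus_L2 f g = f + scaleC (-1) g"

definition scaleR_L2 :: "real \<Rightarrow> 'a L2 \<Rightarrow> 'a L2" where "scaleR_L2 r f = scaleC (of_real r) f"

definition inner_L2 :: "'a L2 \<Rightarrow> 'a L2 \<Rightarrow> real" where "inner_L2 f g = Re (cinner f g)"

definition norm_L2 :: "'a L2 \<Rightarrow> real" where "norm_L2 f = sqrt (inner f f)"

definition sgn_L2 :: "'a L2 \<Rightarrow> 'a L2" where "sgn_L2 f = scaleR (inverse (norm f)) f"

definition dist_L2 :: "'a L2 \<Rightarrow> 'a L2 \<Rightarrow> real" where "dist_L2 f g = norm (f - g)"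

definition uniformity_L2 :: "('a L2 \<times> 'a L2) filter" where
  "uniformity_L2 = (INF e\<in>{0<..}. principal {(x, y). dist x y < e})"

definition open_L2 :: "'a L2 set \<Rightarrow> bool" where
  "open_L2 U = (\<forall>x\<in>U. \<forall>\<^sub>F (x', y) in uniformity. x' = x \<longrightarrow> y \<in> U)"

instance
proof
  fix f g h :: "'a L2" and r s :: real
  have add_assoc: "(f + g) + h = f + (g + h)"
    by transfer (auto simp: L2_rel_def algebra_simps intro!: sq_integrable_add)
  show "(f + g) + h = f + (g + h)" by (rule add_assoc)
  show "f + g = g + f"
    by transfer (auto simp: L2_rel_def algebra_simps intro!: sq_integrable_add)
  show "0 + f = f"
    by transfer (auto simp: L2_rel_def)
  show "- f + f = 0"
    unfolding uminus_L2_def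
    by transfer (auto simp: L2_rel_def sq_integrable_zero intro!: sq_integrable_add sq_integrable_scale)
  show "f - g = f + - g"
    by (simp add: uminus_L2_def minus_L2_def)
  show "r *\<^sub>R (f + g) = r *\<^sub>R f + r *\<^sub>R g"
    unfolding scaleR_L2_def
    by transfer (auto simp: L2_rel_def vec.scale_right_distrib intro!: sq_integrable_add sq_integrable_scale)
  show "(r + s) *\<^sub>R f = r *\<^sub>R f + s *\<^sub>R f"
    unfolding scaleR_L2_def
    by transfer (auto simp: L2_rel_def vec.scale_left_distrib intro!: sq_integrable_add sq_integrable_scale)
  show "r *\<^sub>R s *\<^sub>R f = (r * s) *\<^sub>R f"
    unfolding scaleR_L2_def
    by transfer (auto simp: L2_rel_def intro!: sq_integrable_add sq_integrable_scale)
  show "1 *\<^sub>R f = f"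
    unfolding scaleR_L2_def
    by transfer (auto simp: L2_rel_def intro!: sq_integrable_add sq_integrable_scale)
  have comm: "cinner f g = cnj (cinner g f)"
    by transfer (subst cdot_commute, simp)
  show "inner f g = inner g f"
    by (subst (1) inner_L2_def, subst comm) (simp add: inner_L2_def)
  have "cinner (f + g) h = cinner f h + cinner g h"
    by transfer (auto simp: L2_rel_def cdot_add_left integrable_cdot)
  thus "inner (f + g) h = inner f h + inner g h" by (simp add: inner_L2_def)
  have "cinner (scaleC (of_real r) f) g = of_real r * cinner f g"
    by transfer (auto simp: L2_rel_def cdot_scale_left)
  thus "inner (r *\<^sub>R f) g = r * inner f g" by (simp add: inner_L2_def scaleR_L2_def)
  have self: "Re (cinner f f) \<ge> 0 \<and> (Re (cinner f f) = 0 \<longleftrightarrow> f = 0)"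
  proof (transfer, safe)
    fix f :: "real \<Rightarrow> complex^'a"
    assume "L2_rel f f"
    hence f: "sq_integrable f" by (simp add: L2_rel_def)
    let ?M = "lebesgue_on {0..1}"
    have eq: "(LINT x|?M. cdot (f x) (f x)) = of_real (LINT x|?M. (norm (f x))\<^sup>2)"
      unfolding cdot_self using f unfolding sq_integrable_def by (intro integral_of_real) blast
    show "0 \<le> Re (LINT x|?M. cdot (f x) (f x))"
      unfolding eq by simp
    have iff: "(LINT x|?M. (norm (f x))\<^sup>2) = 0 \<longleftrightarrow> (AE x in ?M. (norm (f x))\<^sup>2 = 0)"
      by (rule integral_nonneg_eq_0_iff_AE[OF conjunct2[OF f[unfolded sq_integrable_def]]]) simp
    show "L2_rel f (\<lambda>_. 0)" if "Re (LINT x|?M. cdot (f x) (f x)) = 0"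
      using that iff f unfolding eq by (simp add: L2_rel_def sq_integrable_zero)
    show "Re (LINT x|?M. cdot (f x) (f x)) = 0" if "L2_rel f (\<lambda>_. 0)"
      using that iff unfolding eq by (simp add: L2_rel_def)
  qed
  show "0 \<le> inner f f" "(inner f f = 0) = (f = 0)"
    using self by (simp_all add: inner_L2_def)
qed (simp_all add: norm_L2_def sgn_L2_def dist_L2_def uniformity_L2_def open_L2_def)

end

interpretation L2: vector_space "scaleC :: complex \<Rightarrow> ('n::finite) L2 \<Rightarrow> 'n L2"
proof
  fix a b :: complex and f g :: "'n L2"
  show "scaleC a (f + g) = scaleC a f + scaleC a g"
    by transfer (auto simp: L2_rel_def vec.scale_right_distrib intro!: sq_integrable_add sq_integrable_scale)
  show "scaleC (a + b) f = scaleC a f + scaleC b f"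
    by transfer (auto simp: L2_rel_def vec.scale_left_distrib intro!: sq_integrable_add sq_integrable_scale)
  show "scaleC a (scaleC b f) = scaleC (a * b) f"
    by transfer (auto simp: L2_rel_def intro!: sq_integrable_scale)
  show "scaleC 1 f = f"
    by transfer (auto simp: L2_rel_def)
qed

section \<open>Completeness and defect\<close>

definition complete_system :: "('n::finite) L2 set \<Rightarrow> bool" where
  "complete_system E \<longleftrightarrow> closure (L2.span E) = UNIV"

definition orth_complement :: "('n::finite) L2 set \<Rightarrow> 'n L2 set" where
  "orth_complement S = {f. \<forall>g\<in>S. cinner f g = 0}"

text \<open>\<^term>\<open>L2.dim\<close> is a natural number and carries no information for infinite-dimensional
  subspaces, hence the detour through \<^typ>\<open>enat\<close>.\<close>

definition subspace_dim :: "('n::finite) L2 set \<Rightarrow> enat" where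
  "subspace_dim V = (if \<exists>S. finite S \<and> V \<subseteq> L2.span S then enat (L2.dim V) else \<infinity>)"

definition defect :: "('n::finite) L2 set \<Rightarrow> enat" where
  "defect E = subspace_dim (orth_complement (closure (L2.span E)))"

section \<open>Root functions of a linear operator\<close>

text \<open>A (partially defined) operator is represented by its graph, so that the powers
  of an operator, with their natural domains, are the relational powers of its graph.\<close>

definition shift_op :: "(('n::finite) L2 \<times> 'n L2) set \<Rightarrow> complex \<Rightarrow> ('n L2 \<times> 'n L2) set" where
  "shift_op L z = {(u, v - scaleC z u) | u v. (u, v) \<in> L}"

definition is_eigenvalue :: "(('n::finite) L2 \<times> 'n L2) set \<Rightarrow> complex \<Rightarrow> bool" where
  "is_eigenvalue L z \<longleftrightarrow> (\<exists>u. u \<noteq> 0 \<and> (u, scaleC z u) \<in> L)"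

definition root_subspace :: "(('n::finite) L2 \<times> 'n L2) set \<Rightarrow> complex \<Rightarrow> 'n L2 set" where
  "root_subspace L z = L2.span (\<Union>k. {u. (u, 0) \<in> shift_op L z ^^ k})"

definition is_basis :: "('n::finite) L2 set \<Rightarrow> 'n L2 set \<Rightarrow> bool" where
  "is_basis S V \<longleftrightarrow> S \<subseteq> V \<and> L2.independent S \<and> L2.span S = V"

definition root_function_system :: "(('n::finite) L2 \<times> 'n L2) set \<Rightarrow> 'n L2 set \<Rightarrow> bool" where
  "root_function_system L E \<longleftrightarrow>
     (\<exists>\<beta>. (\<forall>z. is_eigenvalue L z \<longrightarrow> is_basis (\<beta> z) (root_subspace L z)) \<and>
          E = (\<Union>z\<in>{z. is_eigenvalue L z}. \<beta> z))"

section \<open>The boundary value problem\<close>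

text \<open>\<open>W12_deriv y g\<close>: on the unit interval, \<open>y\<close> is the absolutely continuous representative of an
  element of the Sobolev space \<open>W\<^sup>1\<^sub>2\<close> and \<open>g\<close> is its square-integrable derivative.\<close>

definition W12_deriv :: "(real \<Rightarrow> complex^'n) \<Rightarrow> (real \<Rightarrow> complex^'n) \<Rightarrow> bool" where
  "W12_deriv y g \<longleftrightarrow> sq_integrable g \<and>
     (\<forall>x\<in>{0..1}. y x = y 0 + (LINT t|lebesgue_on {0..x}. g t))"

lemma sq_integrable_imp_integrable:
  assumes "sq_integrable g" shows "integrable (lebesgue_on {0..1}) g"
proof -
  have "integrable (lebesgue_on {0..1::real}) (\<lambda>x. 1 + (norm (g x))\<^sup>2)"
    using assms unfolding sq_integrable_def
    by (intro Bochner_Integration.integrable_add integrable_on_const) auto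
  moreover have "norm v \<le> norm (1 + (norm v)\<^sup>2)" for v :: "complex^'a"
  proof -
    have "norm v \<le> 1 + (norm v)\<^sup>2"
      using sum_squares_bound[of 1 "norm v"] norm_ge_zero[of v] unfolding power_one by linarith
    thus ?thesis by simp
  qed
  ultimately show ?thesis
    using assms unfolding sq_integrable_def
    by (elim Bochner_Integration.integrable_bound) auto
qed

lemma W12_deriv_sq_integrable:
  assumes "W12_deriv y g" shows "sq_integrable y"
proof -
  have "integrable (lebesgue_on {0..1}) g"
    using assms by (auto simp: W12_deriv_def intro: sq_integrable_imp_integrable)
  hence g: "g absolutely_integrable_on {0..1}"
    unfolding set_integrable_def by (subst (asm) integrable_restrict_space) auto
  have sub: "g absolutely_integrable_on {0..x}" if "x \<in> {0..1}" for x
    using g by (rule set_integrable_subset) (use that in auto)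
  have eq: "y x = y 0 + integral {0..x} g" if "x \<in> {0..1}" for x
  proof -
    have "integrable (lebesgue_on {0..x}) g"
      using sub[OF that] unfolding set_integrable_def by (subst integrable_restrict_space) auto
    hence "integral\<^sup>L (lebesgue_on {0..x}) g = integral {0..x} g"
      by (rule lebesgue_integral_eq_integral) auto
    moreover have "y x = y 0 + integral\<^sup>L (lebesgue_on {0..x}) g"
      using assms that unfolding W12_deriv_def by blast
    ultimately show ?thesis by (simp only:)
  qed
  have "continuous_on {0..1} (\<lambda>x. y 0 + integral {0..x} g)"
    using g by (intro continuous_intros indefinite_integral_continuous_1 set_lebesgue_integral_eq_integral(1))
  hence cont: "continuous_on {0..1} y"
    by (rule continuous_on_eq) (rule eq[symmetric])
  have "integrable (lebesgue_on {0..1}) (\<lambda>x. (norm (y x))\<^sup>2)"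
    by (intro continuous_imp_integrable_real continuous_intros cont)
  moreover have "y \<in> borel_measurable (lebesgue_on {0..1})"
    by (intro continuous_imp_measurable_on_sets_lebesgue cont) auto
  ultimately show ?thesis by (simp add: sq_integrable_def)
qed

definition bvp_op :: "complex^'n^'n \<Rightarrow> complex^'n^'n \<Rightarrow> complex^'n^'n \<Rightarrow> (('n::finite) L2 \<times> 'n L2) set" where
  "bvp_op B C D = {(to_L2 y, to_L2 (\<lambda>x. (-\<i>) *s (B *v g x))) | y g.
     W12_deriv y g \<and> C *v y 0 + D *v y 1 = 0}"

section \<open>Matrices\<close>

text \<open>The \<open>j\<close>-th diagonal block consists of the indices \<open>i\<close> with \<open>blk i = j\<close>; its size is
  the cardinality of this fibre.\<close>

definition block_diag :: "('n \<Rightarrow> 'r) \<Rightarrow> ('r \<Rightarrow> complex) \<Rightarrow> complex^'n^'n" where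
  "block_diag blk d = (\<chi> i k. if i = k then d (blk i) else 0)"

definition adjoint_matrix :: "complex^'n^'m \<Rightarrow> complex^'m^'n" where
  "adjoint_matrix A = (\<chi> i j. cnj (A $ j $ i))"

definition hcat :: "complex^'n^'m \<Rightarrow> complex^'k^'m \<Rightarrow> complex^('n + 'k)^'m" where
  "hcat C D = (\<chi> i s. case s of Inl j \<Rightarrow> C $ i $ j | Inr j \<Rightarrow> D $ i $ j)"

definition spectral_subspace :: "complex^'n^'n \<Rightarrow> complex set \<Rightarrow> (complex^'n) set" where
  "spectral_subspace A S =
     vec.span (\<Union>z\<in>S. \<Union>k. {v. ((\<lambda>w. A *v w - z *s w) ^^ k) v = 0})"

definition spectral_projector :: "complex^'n^'n \<Rightarrow> complex set \<Rightarrow> complex^'n^'n" where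
  "spectral_projector A S = (THE P. P ** P = P \<and>
     range ((*v) P) = spectral_subspace A S \<and>
     {v. P *v v = 0} = spectral_subspace A (- S))"

definition proj_pos :: "complex^'n^'n \<Rightarrow> complex^'n^'n" where
  "proj_pos B = spectral_projector B (complex_of_real ` {0<..})"

definition proj_neg :: "complex^'n^'n \<Rightarrow> complex^'n^'n" where
  "proj_neg B = spectral_projector B (complex_of_real ` {..<0})"

lemma block_diag_mult_vec: "(block_diag blk d *v v) $ i = d (blk i) * v $ i"
  by (simp add: block_diag_def matrix_vector_mult_def if_distrib[of "\<lambda>x. x * _"] cong: if_cong)

lemma spectral_subspace_block_diag:
  "spectral_subspace (block_diag blk d) S = {v. \<forall>i. d (blk i) \<notin> S \<longrightarrow> v $ i = 0}"
proof -
  let ?A = "block_diag blk d"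
  have pow: "((\<lambda>w. ?A *v w - z *s w) ^^ k) v $ i = (d (blk i) - z) ^ k * v $ i" for z k v i
    by (induction k) (simp_all add: block_diag_mult_vec algebra_simps)
  let ?U = "\<Union>z\<in>S. \<Union>k. {v. ((\<lambda>w. ?A *v w - z *s w) ^^ k) v = 0}"
  let ?V = "{v :: complex^'a. \<forall>i. d (blk i) \<notin> S \<longrightarrow> v $ i = 0}"
  show ?thesis unfolding spectral_subspace_def
  proof
    have "vec.subspace ?V"
      by (auto simp: vec.subspace_def)
    moreover have "?U \<subseteq> ?V"
    proof safe
      fix z k v i
      assume "z \<in> S" "((\<lambda>w. ?A *v w - z *s w) ^^ k) v = 0" "d (blk i) \<notin> S"
      thus "v $ i = 0" using pow[of k z v i] by auto
    qed
    ultimately show "vec.span ?U \<subseteq> ?V" by (simp add: vec.span_minimal)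
    show "?V \<subseteq> vec.span ?U"
    proof
      fix v assume v: "v \<in> ?V"
      have "v $ i *s axis i 1 \<in> vec.span ?U" for i
      proof (cases "d (blk i) \<in> S")
        case True
        have "((\<lambda>w. ?A *v w - d (blk i) *s w) ^^ 1) (axis i 1) = 0"
          unfolding vec_eq_iff pow by (simp add: axis_def)
        hence "axis i 1 \<in> ?U" using True by blast
        thus ?thesis by (intro vec.span_scale vec.span_base)
      next
        case False
        hence "v $ i = 0" using v by auto
        thus ?thesis by (simp add: vec.span_zero)
      qed
      hence "(\<Sum>i\<in>UNIV. v $ i *s axis i 1) \<in> vec.span ?U" by (intro vec.span_sum) auto
      thus "v \<in> vec.span ?U" by (simp add: basis_expansion)
    qed
  qed
qed

lemma spectral_projector_block_diag:
  "spectral_projector (block_diag blk d) S = block_diag blk (\<lambda>j. if d j \<in> S then 1 else 0)"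
  (is "_ = ?P")
  unfolding spectral_projector_def spectral_subspace_block_diag
proof (rule the_equality)
  have idem: "?P *v (?P *v v) = ?P *v v" for v
    by (simp add: vec_eq_iff block_diag_mult_vec)
  have "?P ** ?P = ?P"
    by (rule matrix_eq[THEN iffD2]) (simp add: matrix_vector_mul_assoc[symmetric] idem)
  moreover have "v \<in> range ((*v) ?P)" if "\<forall>i. d (blk i) \<notin> S \<longrightarrow> v $ i = 0" for v
    by (rule range_eqI[of _ _ v]) (use that in \<open>auto simp: vec_eq_iff block_diag_mult_vec\<close>)
  ultimately show "?P ** ?P = ?P \<and>
      range ((*v) ?P) = {v. \<forall>i. d (blk i) \<notin> S \<longrightarrow> v $ i = 0} \<and>
      {v. ?P *v v = 0} = {v. \<forall>i. d (blk i) \<notin> - S \<longrightarrow> v $ i = 0}"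
    by (auto simp: vec_eq_iff block_diag_mult_vec)
next
  fix P :: "complex^'a^'a"
  assume P: "P ** P = P \<and>
      range ((*v) P) = {v. \<forall>i. d (blk i) \<notin> S \<longrightarrow> v $ i = 0} \<and>
      {v. P *v v = 0} = {v. \<forall>i. d (blk i) \<notin> - S \<longrightarrow> v $ i = 0}"
  have "P *v v = ?P *v v" for v
  proof -
    have "P *v (v - ?P *v v) = 0"
    proof -
      have "v - ?P *v v \<in> {v. \<forall>i. d (blk i) \<notin> - S \<longrightarrow> v $ i = 0}"
        by (auto simp: block_diag_mult_vec)
      thus ?thesis using P by blast
    qed
    moreover have "P *v (?P *v v) = ?P *v v"
    proof -
      have "?P *v v \<in> {v. \<forall>i. d (blk i) \<notin> S \<longrightarrow> v $ i = 0}"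
        by (auto simp: block_diag_mult_vec)
      then obtain w where "?P *v v = P *v w" using P by blast
      thus ?thesis using P by (simp add: matrix_vector_mul_assoc)
    qed
    ultimately show ?thesis by (simp add: matrix_vector_mult_diff_distrib)
  qed
  thus "P = ?P" by (simp add: matrix_eq)
qed

end

theory Submission
  imports Defs
begin

text \<open>Write \<open>\<beta>\<^sub>i\<close> for the entry of \<open>B\<^sup>-\<^sup>1\<close> in position \<open>i\<close>, which is real since \<open>B\<close>
  is self-adjoint. A nonzero row vector annihilating \<open>C P\<^sub>- + D P\<^sub>+\<close> turns the boundary
  conditions into one nontrivial relation that involves only the values \<open>y\<^sub>i(0)\<close> with \<open>\<beta>\<^sub>i > 0\<close> and the values \<open>y\<^sub>i(1)\<close> with \<open>\<beta>\<^sub>i < 0\<close>, say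
  \<open>\<Sum>\<^sub>i \<alpha>\<^sub>i y\<^sub>i(e\<^sub>i) = 0\<close>. Put \<open>F\<^sub>y(t) = \<Sum>\<^sub>i \<alpha>\<^sub>i y\<^sub>i(e\<^sub>i + t/\<beta>\<^sub>i)\<close> for \<open>0 \<le> t \<le> m = min\<^sub>i |\<beta>\<^sub>i|\<close>. The
  components move along these characteristics at matching speeds, so \<open>F\<^sub>y' = \<i> F\<^bsub>Ly\<^esub>\<close>, and
  \<open>F\<^sub>y(0) = 0\<close> on the domain of \<open>L\<close>. Hence if \<open>F\<^bsub>(L - z)y\<^esub> = 0\<close> then \<open>F\<^sub>y\<close> solves \<open>F' = \<i> z F\<close>,
  \<open>F(0) = 0\<close> and vanishes, so by induction \<open>F\<^sub>y = 0\<close> for every root function. Integrating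
  \<open>F\<^sub>y\<close> over disjoint subintervals of \<open>[0, m]\<close> exhibits infinitely many pairwise orthogonal
  elements of the orthogonal complement.\<close>

section \<open>Complex inner product, orthogonal complements and infinite dimension\<close>

lemma cinner_to_L2:
  assumes "sq_integrable f" "sq_integrable g"
  shows "cinner (to_L2 f) (to_L2 g) = (LINT x|lebesgue_on {0..1}. cdot (f x) (g x))"
  using assms by (intro cinner.abs_eq) (auto simp: L2_rel_def)

lemma cinner_commute: "cinner g f = cnj (cinner f g)"
  by transfer (subst cdot_commute, simp)

lemma cinner_add_left: "cinner (f + g) h = cinner f h + cinner g h"
  by transfer (auto simp: L2_rel_def cdot_add_left integrable_cdot)

lemma cinner_scaleC_left: "cinner (scaleC a f) h = a * cinner f h"
  by transfer (auto simp: L2_rel_def cdot_scale_left)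

lemma cinner_scaleC_right: "cinner f (scaleC a h) = cnj a * cinner f h"
  by (metis cinner_commute cinner_scaleC_left complex_cnj_mult)

lemma cinner_zero_left [simp]: "cinner 0 h = 0"
  using cinner_scaleC_left[of 0 0 h] by simp

lemma cinner_diff_left: "cinner (f - g) h = cinner f h - cinner g h"
  unfolding minus_L2_def cinner_add_left cinner_scaleC_left by simp

lemma cinner_sum_left: "cinner (\<Sum>i\<in>A. f i) h = (\<Sum>i\<in>A. cinner (f i) h)"
  by (induction A rule: infinite_finite_induct) (simp_all add: cinner_add_left)

lemma cinner_self_eq_0: "cinner f f = 0 \<Longrightarrow> f = 0"
  by (metis inner_L2_def inner_eq_zero_iff zero_complex.simps(1))

text \<open>The topology comes from the real inner product, which sees only
  \<open>Re (cinner u h)\<close>. Pairing with \<open>scaleC \<i> h\<close> recovers the imaginary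
  part, so complex orthogonality is two closed real conditions.\<close>

lemma closed_cinner_zero: "closed {u. cinner u h = 0}"
proof -
  have "cinner u h = 0 \<longleftrightarrow> inner u h = 0 \<and> inner u (scaleC \<i> h) = 0" for u
    by (auto simp: inner_L2_def cinner_scaleC_right complex_eq_iff)
  moreover have "closed {u. inner u h = 0 \<and> inner u (scaleC \<i> h) = 0}"
    by (intro closed_Collect_conj closed_Collect_eq continuous_intros)
  ultimately show ?thesis by simp
qed

lemma subspace_cinner_zero: "L2.subspace {u. cinner u h = 0}"
  by (auto simp: L2.subspace_def cinner_add_left cinner_scaleC_left)

lemma orth_complement_closure_span:
  assumes "\<And>u. u \<in> E \<Longrightarrow> cinner u h = 0"
  shows "h \<in> orth_complement (closure (L2.span E))"
proof -
  have "L2.span E \<subseteq> {u. cinner u h = 0}"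
    using assms by (intro L2.span_minimal subspace_cinner_zero) auto
  then have "closure (L2.span E) \<subseteq> {u. cinner u h = 0}"
    by (intro closure_minimal closed_cinner_zero)
  then have "cinner u h = 0" if "u \<in> closure (L2.span E)" for u
    using that by blast
  then show ?thesis
    unfolding orth_complement_def using cinner_commute[of h] by simp
qed

text \<open>Pairing a vanishing linear combination with one of its members isolates the coefficient
  of that member.\<close>

lemma independent_orthogonal:
  assumes "\<And>f g. f \<in> S \<Longrightarrow> g \<in> S \<Longrightarrow> f \<noteq> g \<Longrightarrow> cinner f g = 0"
    and "0 \<notin> S"
  shows "L2.independent S"
proof
  assume "L2.dependent S"
  then obtain T c h where T: "finite T" "T \<subseteq> S" and sum: "(\<Sum>v\<in>T. scaleC (c v) v) = 0"
    and h: "h \<in> T" "c h \<noteq> 0"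
    unfolding L2.dependent_explicit by blast
  have "(\<Sum>v\<in>T. cinner (scaleC (c v) v) h) = 0"
    using arg_cong[OF sum, of "\<lambda>u. cinner u h"] by (simp add: cinner_sum_left)
  also have "(\<Sum>v\<in>T. cinner (scaleC (c v) v) h) = (\<Sum>v\<in>T. if v = h then c h * cinner h h else 0)"
    using assms(1) T h by (intro sum.cong) (auto simp: cinner_scaleC_left subset_iff)
  also have "\<dots> = c h * cinner h h"
    using T h by simp
  finally have "h = 0" using h cinner_self_eq_0 by auto
  with h T assms(2) show False by auto
qed

lemma subspace_dim_infinite:
  assumes "infinite S" "L2.independent S" "S \<subseteq> V"
  shows "subspace_dim V = \<infinity>"
proof -
  have False if "finite T" "V \<subseteq> L2.span T" for T
    using L2.independent_span_bound[OF that(1) assms(2)] assms(1,3) that(2) by blast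
  then show ?thesis by (auto simp: subspace_dim_def)
qed

section \<open>A linear differential equation and components of Sobolev functions\<close>

lemma linear_ode_zero:
  fixes G :: "real \<Rightarrow> complex"
  assumes "\<And>t. t \<in> {0..m} \<Longrightarrow> (G has_vector_derivative k * G t) (at t within {0..m})"
    and "G 0 = 0" and t: "t \<in> {0..m}"
  shows "G t = 0"
proof -
  \<comment> \<open>Integrating factor: the two terms of the derivative cancel, so \<open>?H\<close>
    keeps its value at \<open>0\<close>, which is zero.\<close>
  let ?H = "\<lambda>t. exp (- (k * of_real t)) * G t"
  have "(?H has_vector_derivative 0) (at t within {0..m})" if t: "t \<in> {0..m}" for t
  proof -
    have "((\<lambda>z. exp (- (k * z))) has_field_derivative exp (- (k * of_real t)) * (- k)) (at (of_real t))"
      by (auto intro!: derivative_eq_intros)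
    then have "((\<lambda>t. exp (- (k * of_real t))) has_vector_derivative exp (- (k * of_real t)) * (- k))
        (at t within {0..m})"
      by (rule has_vector_derivative_real_field)
    from has_vector_derivative_mult[OF this assms(1)[OF t]] show ?thesis
      by (simp add: algebra_simps)
  qed
  then obtain c where c: "\<And>t. t \<in> {0..m} \<Longrightarrow> ?H t = c"
    using has_vector_derivative_zero_constant[of "{0..m}" ?H] by (metis convex_real_interval(5))
  have "c = 0" using c[of 0] t assms(2) by simp
  then show ?thesis using c[OF t] by simp
qed

lemma sq_integrable_component:
  assumes "sq_integrable f"
  shows "integrable (lebesgue_on {0..1}) (\<lambda>x. f x $ i)"
  using integrable_bounded_linear[OF bounded_linear_vec_nth sq_integrable_imp_integrable[OF assms]] .

lemma bounded_linear_matrix_vector_mult: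
  "bounded_linear (\<lambda>v. (A :: complex^'n^'m) *v v)"
  unfolding linear_conv_bounded_linear[symmetric]
  by (rule linearI) (simp_all add: matrix_vector_mult_def vec_eq_iff scaleR_sum_right
      sum.distrib distrib_left)

lemma sq_integrable_matrix_vector_mult:
  assumes "sq_integrable f"
  shows "sq_integrable (\<lambda>x. (A :: complex^'n^'m) *v f x)"
proof -
  obtain K where K: "\<And>v. norm (A *v v) \<le> norm v * K"
    using bounded_linear.bounded[OF bounded_linear_matrix_vector_mult[of A]] by auto
  have meas [measurable]: "(\<lambda>x. A *v f x) \<in> borel_measurable (lebesgue_on {0..1})"
    using assms borel_measurable_continuous_onI[OF
        linear_continuous_on[OF bounded_linear_matrix_vector_mult]]
    unfolding sq_integrable_def by (blast intro: measurable_compose)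
  have "integrable (lebesgue_on {0..1}) (\<lambda>x. K\<^sup>2 * (norm (f x))\<^sup>2)"
    using assms by (auto simp: sq_integrable_def)
  then have "integrable (lebesgue_on {0..1}) (\<lambda>x. (norm (A *v f x))\<^sup>2)"
  proof (rule Bochner_Integration.integrable_bound)
    have "(norm (A *v v))\<^sup>2 \<le> K\<^sup>2 * (norm v)\<^sup>2" for v
      using power_mono[OF K, of v 2] by (simp add: power_mult_distrib mult.commute)
    then show "AE x in lebesgue_on {0..1}.
        norm ((norm (A *v f x))\<^sup>2) \<le> norm (K\<^sup>2 * (norm (f x))\<^sup>2)"
      by (intro AE_I2) simp
  qed measurable
  with meas show ?thesis by (simp add: sq_integrable_def)
qed

lemma lebesgue_on_unit_imp_integrable_on:
  fixes f :: "real \<Rightarrow> complex"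
  assumes "integrable (lebesgue_on {0..1}) f" "0 \<le> a" "b \<le> 1"
  shows "f integrable_on {a..b}"
  by (rule integrable_subinterval_real[OF integrable_on_lebesgue_on[OF assms(1)]]) (use assms in auto)

text \<open>Passes from the Bochner integral in \<open>W12_deriv\<close> to the Henstock-Kurzweil
  integral of one component, the form in which primitives are combined and differentiated
  below.\<close>

lemma W12_deriv_component:
  assumes "W12_deriv y g" "x \<in> {0..1}"
  shows "y x $ i = y 0 $ i + integral {0..x} (\<lambda>t. g t $ i)"
proof -
  have g: "integrable (lebesgue_on {0..1}) g"
    using assms by (auto simp: W12_deriv_def intro: sq_integrable_imp_integrable)
  then have gx: "integrable (lebesgue_on {0..x}) g"
    using assms(2) by (intro integrable_subinterval[of 0 1 g 0 x]) auto
  have "(LINT t|lebesgue_on {0..x}. g t) $ i = (LINT t|lebesgue_on {0..x}. g t $ i)"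
    using integral_bounded_linear[OF bounded_linear_vec_nth gx] by simp
  also have "\<dots> = integral {0..x} (\<lambda>t. g t $ i)"
    by (intro lebesgue_integral_eq_integral integrable_bounded_linear[OF bounded_linear_vec_nth gx]) auto
  finally show ?thesis
    using assms unfolding W12_deriv_def by (metis vector_add_component)
qed

lemma W12_deriv_continuous:
  assumes "W12_deriv y g"
  shows "continuous_on {0..1} (\<lambda>x. y x $ i)"
proof -
  have "(\<lambda>t. g t $ i) integrable_on {0..1}"
    using assms by (intro lebesgue_on_unit_imp_integrable_on sq_integrable_component)
      (auto simp: W12_deriv_def)
  then have "continuous_on {0..1} (\<lambda>x. y 0 $ i + integral {0..x} (\<lambda>t. g t $ i))"
    by (intro continuous_intros indefinite_integral_continuous_1)
  then show ?thesis
    by (rule continuous_on_eq) (rule W12_deriv_component[OF assms, symmetric])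
qed

section \<open>Characteristics and the slabs along them\<close>

locale characteristics =
  fixes \<beta> :: "'n::finite \<Rightarrow> real" and m :: real
  assumes \<beta>_nonzero: "\<beta> i \<noteq> 0" and m_pos: "0 < m" and m_le: "m \<le> \<bar>\<beta> i\<bar>"
begin

text \<open>The characteristic of component \<open>i\<close> starts at the left end if
  \<open>\<beta> i\<close> is positive and at the right end otherwise, and moves inwards with
  velocity \<open>1 / \<beta> i\<close>. Up to time \<open>m\<close> it stays in the unit interval
  because \<open>m\<close> is at most \<open>\<bar>\<beta> i\<bar>\<close>.\<close>

definition charpt :: "'n \<Rightarrow> real \<Rightarrow> real" where
  "charpt i t = (if \<beta> i > 0 then 0 else 1) + t / \<beta> i"

text \<open>The weights make the inner product of \<open>y\<close> with \<open>slab \<alpha> s t\<close> equal to the integral of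
  \<open>\<Sum>\<^sub>i \<alpha>\<^sub>i y\<^sub>i(charpt i \<tau>)\<close> over \<open>s < \<tau> \<le> t\<close>.\<close>

definition slab :: "('n \<Rightarrow> complex) \<Rightarrow> real \<Rightarrow> real \<Rightarrow> real \<Rightarrow> complex^'n" where
  "slab \<alpha> s t x = (\<chi> i. if x \<in> charpt i ` {s<..t} then cnj (\<alpha> i) * of_real \<bar>\<beta> i\<bar> else 0)"

lemma charpt_mem:
  assumes "t \<in> {0..m}"
  shows "charpt i t \<in> {0..1}"
  using assms m_le[of i] \<beta>_nonzero[of i] by (auto simp: charpt_def divide_simps)

lemma charpt_image:
  "charpt i ` {s<..t} = (if \<beta> i > 0 then {charpt i s<..charpt i t} else {charpt i t..<charpt i s})"
proof -
  define e where "e = (if \<beta> i > 0 then 0 else 1 :: real)"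
  have c: "charpt i t = e + t / \<beta> i" for t by (simp add: charpt_def e_def)
  have "x \<in> charpt i ` {s<..t} \<longleftrightarrow> \<beta> i * (x - e) \<in> {s<..t}" for x
  proof
    assume "\<beta> i * (x - e) \<in> {s<..t}"
    then show "x \<in> charpt i ` {s<..t}"
      by (intro image_eqI[of _ _ "\<beta> i * (x - e)"]) (use \<beta>_nonzero[of i] in \<open>auto simp: c\<close>)
  qed (use \<beta>_nonzero[of i] in \<open>auto simp: c\<close>)
  then show ?thesis
    using \<beta>_nonzero[of i] by (auto simp: c field_simps)
qed

lemma inj_charpt: "inj (charpt i)"
  using \<beta>_nonzero[of i] by (auto simp: inj_def charpt_def)

text \<open>Both signs of \<open>\<beta> i\<close> give one formula: for negative
  \<open>\<beta> i\<close> the characteristic runs to the left, so the difference of primitives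
  changes sign, and this sign turns \<open>\<bar>\<beta> i\<bar>\<close> into
  \<open>\<beta> i\<close>.\<close>

lemma integral_charpt_image:
  fixes f :: "real \<Rightarrow> complex"
  assumes f: "integrable (lebesgue_on {0..1}) f" and st: "0 \<le> s" "s \<le> t" "t \<le> m"
  shows "of_real \<bar>\<beta> i\<bar> * (LINT x|lebesgue_on {0..1}. (if x \<in> charpt i ` {s<..t} then f x else 0))
       = of_real (\<beta> i) * (integral {0..charpt i t} f - integral {0..charpt i s} f)"
proof -
  define I where "I = charpt i ` {s<..t}"
  have mem: "charpt i s \<in> {0..1}" "charpt i t \<in> {0..1}"
    using st by (intro charpt_mem; simp)+
  have I: "I \<in> sets lebesgue" "I \<subseteq> {0..1}"
    using mem by (auto simp: I_def charpt_image)
  have int: "(LINT x|lebesgue_on {0..1}. (if x \<in> I then f x else 0)) = integral I f"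
  proof -
    have "(LINT x|lebesgue_on {0..1}. (if x \<in> I then f x else 0))
        = integral {0..1} (\<lambda>x. if x \<in> I then f x else 0)"
    proof (rule lebesgue_integral_eq_integral)
      have "I \<in> sets (lebesgue_on {0..1})"
        using I by (simp add: sets_restrict_space_iff)
      then have "integrable (lebesgue_on {0..1}) (\<lambda>x. indicator I x *\<^sub>R f x)"
        by (rule integrable_mult_indicator) (rule f)
      also have "(\<lambda>x. indicator I x *\<^sub>R f x) = (\<lambda>x. if x \<in> I then f x else 0)"
        by auto
      finally show "integrable (lebesgue_on {0..1}) (\<lambda>x. if x \<in> I then f x else 0)" .
    qed auto
    also have "\<dots> = integral I f"
      using I(2) by (simp add: Henstock_Kurzweil_Integration.integral_restrict_Int Int_absorb2)
    finally show ?thesis .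
  qed
  show ?thesis
  proof (cases "\<beta> i > 0")
    case True
    have "charpt i s \<le> charpt i t" using True st by (simp add: charpt_def divide_right_mono)
    \<comment> \<open>The half-open image and the closed interval differ at most at the two end
      points.\<close>
    moreover have "integral I f = integral {charpt i s..charpt i t} f"
      by (rule integral_spike_set; rule negligible_subset[of "{charpt i s, charpt i t}"])
        (auto simp: I_def charpt_image True)
    ultimately have "integral {0..charpt i t} f = integral {0..charpt i s} f + integral I f"
      using Henstock_Kurzweil_Integration.integral_combine[of 0 "charpt i s" "charpt i t" f]
        lebesgue_on_unit_imp_integrable_on[OF f, of 0 "charpt i t"] mem by simp
    then show ?thesis
      using True unfolding I_def[symmetric] int by simp
  next
    case False
    then have neg: "\<beta> i < 0" using \<beta>_nonzero[of i] by simp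
    have "charpt i t \<le> charpt i s" using neg st by (simp add: charpt_def divide_right_mono_neg)
    moreover have "integral I f = integral {charpt i t..charpt i s} f"
      by (rule integral_spike_set; rule negligible_subset[of "{charpt i s, charpt i t}"])
        (auto simp: I_def charpt_image False)
    ultimately have "integral {0..charpt i s} f = integral {0..charpt i t} f + integral I f"
      using Henstock_Kurzweil_Integration.integral_combine[of 0 "charpt i t" "charpt i s" f]
        lebesgue_on_unit_imp_integrable_on[OF f, of 0 "charpt i s"] mem by simp
    then show ?thesis
      using neg unfolding I_def[symmetric] int by simp
  qed
qed

lemma sq_integrable_slab: "sq_integrable (slab \<alpha> s t)"
proof -
  have eq: "slab \<alpha> s t x = (\<Sum>i\<in>UNIV. indicator (charpt i ` {s<..t}) x *\<^sub>R
      axis i (cnj (\<alpha> i) * of_real \<bar>\<beta> i\<bar>))" for x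
    by (auto simp: vec_eq_iff slab_def axis_def if_distrib[of "\<lambda>a. _ *\<^sub>R a"]
        indicator_def cong: if_cong)
  have set: "charpt i ` {s<..t} \<in> sets borel" for i
    by (simp add: charpt_image)
  have "slab \<alpha> s t \<in> borel_measurable borel"
    unfolding eq[abs_def] using set by measurable
  then have meas [measurable]: "slab \<alpha> s t \<in> borel_measurable (lebesgue_on {0..1})"
    by (intro measurable_restrict_space1 measurable_completion) simp
  define M where "M = (\<Sum>i\<in>UNIV. norm (\<alpha> i) * \<bar>\<beta> i\<bar>)"
  have bound: "norm (slab \<alpha> s t x) \<le> M" for x
  proof -
    have "norm (slab \<alpha> s t x) \<le> (\<Sum>i\<in>UNIV. norm (slab \<alpha> s t x $ i))"
      unfolding norm_vec_def by (intro L2_set_le_sum) auto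
    also have "\<dots> \<le> M"
      unfolding M_def by (intro sum_mono) (auto simp: slab_def norm_mult)
    finally show ?thesis .
  qed
  have "integrable (lebesgue_on {0..1::real}) (\<lambda>x. M\<^sup>2)"
    by auto
  then have "integrable (lebesgue_on {0..1}) (\<lambda>x. (norm (slab \<alpha> s t x))\<^sup>2)"
    by (rule Bochner_Integration.integrable_bound)
      (auto intro!: AE_I2 power_mono bound)
  with meas show ?thesis by (simp add: sq_integrable_def)
qed

text \<open>Expresses the pairing through primitives evaluated on the characteristics, a form that
  can be differentiated in \<open>t\<close>.\<close>

lemma cinner_slab:
  assumes f: "sq_integrable f" and st: "0 \<le> s" "s \<le> t" "t \<le> m"
  shows "cinner (to_L2 f) (to_L2 (slab \<alpha> s t)) =
    (\<Sum>i\<in>UNIV. \<alpha> i * (of_real (\<beta> i) *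
      (integral {0..charpt i t} (\<lambda>x. f x $ i) - integral {0..charpt i s} (\<lambda>x. f x $ i))))"
proof -
  let ?I = "\<lambda>i. charpt i ` {s<..t}"
  have meas: "?I i \<inter> {0..1} \<in> sets lebesgue" for i
    by (auto simp: charpt_image)
  have int: "integrable (lebesgue_on {0..1}) (\<lambda>x. if x \<in> ?I i then f x $ i else 0)" for i
  proof -
    have "integrable (lebesgue_on {0..1}) (\<lambda>x. indicator (?I i \<inter> {0..1}) x *\<^sub>R (f x $ i))"
      using meas by (intro integrable_mult_indicator sq_integrable_component f)
        (simp add: sets_restrict_space_iff)
    also have "?this \<longleftrightarrow> ?thesis"
      by (intro Bochner_Integration.integrable_cong) (auto simp: indicator_def)
    finally show ?thesis .
  qed
  have "cdot (f x) (slab \<alpha> s t x) =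
      (\<Sum>i\<in>UNIV. \<alpha> i * (of_real \<bar>\<beta> i\<bar> * (if x \<in> ?I i then f x $ i else 0)))" for x
    unfolding cdot_def by (intro sum.cong) (auto simp: slab_def)
  then have "cinner (to_L2 f) (to_L2 (slab \<alpha> s t)) = (\<Sum>i\<in>UNIV. \<alpha> i * (of_real \<bar>\<beta> i\<bar> *
      (LINT x|lebesgue_on {0..1}. (if x \<in> ?I i then f x $ i else 0))))"
    using int by (simp add: cinner_to_L2 f sq_integrable_slab)
  also have "\<dots> = (\<Sum>i\<in>UNIV. \<alpha> i * (of_real (\<beta> i) *
      (integral {0..charpt i t} (\<lambda>x. f x $ i) - integral {0..charpt i s} (\<lambda>x. f x $ i))))"
    by (intro sum.cong refl arg_cong2[where f = "(*)"] integral_charpt_image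
        sq_integrable_component f st)
  finally show ?thesis .
qed

text \<open>Each \<open>charpt i\<close> is injective, so disjoint time intervals have disjoint
  images in every component.\<close>

lemma slab_orthogonal:
  assumes "t \<le> s' \<or> t' \<le> s"
  shows "cinner (to_L2 (slab \<alpha> s t)) (to_L2 (slab \<alpha> s' t')) = 0"
proof -
  have "charpt i ` {s<..t} \<inter> charpt i ` {s'<..t'} = {}" for i
    using assms by (auto simp: image_Int[OF inj_charpt, symmetric])
  then have "slab \<alpha> s t x $ i * cnj (slab \<alpha> s' t' x $ i) = 0" for x i
    by (auto simp: slab_def)
  then have "cdot (slab \<alpha> s t x) (slab \<alpha> s' t' x) = 0" for x
    unfolding cdot_def by (intro sum.neutral) blast
  then show ?thesis
    by (simp add: cinner_to_L2 sq_integrable_slab)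
qed

text \<open>Pairing with the constant function \<open>axis k 1\<close> isolates component
  \<open>k\<close>, where the factor \<open>\<beta> k\<close> cancels the velocity and leaves
  \<open>\<alpha> k * (t - s)\<close>.\<close>

lemma slab_nonzero:
  assumes "\<alpha> k \<noteq> 0" and st: "0 \<le> s" "s < t" "t \<le> m"
  shows "to_L2 (slab \<alpha> s t) \<noteq> 0"
proof
  assume zero: "to_L2 (slab \<alpha> s t) = 0"
  have sq: "sq_integrable (\<lambda>_. axis k 1 :: complex^'n)"
    by (auto simp: sq_integrable_def intro!: integrable_on_const)
  have mem: "charpt i s \<in> {0..1}" "charpt i t \<in> {0..1}" for i
    using st by (intro charpt_mem; simp)+
  have "0 = cinner (to_L2 (\<lambda>_. axis k 1)) (to_L2 (slab \<alpha> s t))"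
    unfolding zero using cinner_commute[of _ 0] by simp
  also have "\<dots> = (\<Sum>i\<in>UNIV. \<alpha> i * (of_real (\<beta> i) *
      ((charpt i t - charpt i s) *\<^sub>R (axis k 1 $ i))))"
    using mem by (subst cinner_slab[OF sq]) (use st in \<open>auto simp: algebra_simps\<close>)
  also have "\<dots> = (\<Sum>i\<in>UNIV. if i = k then \<alpha> k * of_real (t - s) else 0)"
    using \<beta>_nonzero by (intro sum.cong) (auto simp: axis_def charpt_def scaleR_conv_of_real field_simps)
  also have "\<dots> = \<alpha> k * of_real (t - s)"
    by simp
  finally show False using assms by simp
qed

lemma infinite_orthogonal_slabs:
  assumes "\<alpha> k \<noteq> 0"
  obtains S where "infinite S" "L2.independent S"
    "\<And>h. h \<in> S \<Longrightarrow> \<exists>s t. 0 \<le> s \<and> s \<le> t \<and> t \<le> m \<and> h = to_L2 (slab \<alpha> s t)"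
proof -
  \<comment> \<open>A strictly decreasing sequence starting at \<open>m\<close>; the intervals
    \<open>{p (Suc j)<..p j}\<close> are therefore nonempty, pairwise disjoint and contained in
    \<open>{0..m}\<close>.\<close>
  define p :: "nat \<Rightarrow> real" where "p j = m / real (Suc j)" for j
  define h where "h j = to_L2 (slab \<alpha> (p (Suc j)) (p j))" for j
  have p: "0 \<le> p j" "p j \<le> m" "p (Suc j) < p j" for j
    using m_pos by (auto simp: p_def field_simps)
  have anti: "p j \<le> p k" if "k \<le> j" for j k
    using that m_pos by (auto simp: p_def intro!: divide_left_mono)
  have nz: "h j \<noteq> 0" for j
    unfolding h_def by (intro slab_nonzero[of \<alpha> k] assms p)
  have orth: "cinner (h j) (h l) = 0" if "j \<noteq> l" for j l
    unfolding h_def using that anti[of "Suc j" l] anti[of "Suc l" j]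
    by (intro slab_orthogonal) linarith
  have "inj h"
    using orth nz cinner_self_eq_0 by (metis injI)
  then have "infinite (range h)"
    by (rule range_inj_infinite)
  moreover have "L2.independent (range h)"
    using orth nz by (intro independent_orthogonal) (auto, metis)
  moreover have "\<exists>s t. 0 \<le> s \<and> s \<le> t \<and> t \<le> m \<and> f = to_L2 (slab \<alpha> s t)" if "f \<in> range h" for f
    using that p less_imp_le[OF p(3)] unfolding h_def by blast
  ultimately show thesis by (rule that)
qed

text \<open>One step of the induction on root vectors. Since (L - z)y is controlled only through its
  pairings with slabs, the differential equation is derived for \<open>G\<close>, the integral of
  \<open>F\<close> from \<open>0\<close> to \<open>t\<close>: pairing Ly with a slab returns the
  values \<open>F t\<close>, so the hypothesis reads \<open>F t = \<i> * z * G t\<close>, while the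
  derivative of \<open>G\<close> is \<open>F\<close>.\<close>

lemma cinner_slab_solution:
  assumes y: "W12_deriv y g"
    and bc: "(\<Sum>i\<in>UNIV. \<alpha> i * y (charpt i 0) $ i) = 0"
    and B: "\<And>v i. (B *v v) $ i = of_real (inverse (\<beta> i)) * v $ i"
    and v: "\<And>t. 0 \<le> t \<Longrightarrow> t \<le> m \<Longrightarrow> cinner (to_L2 (\<lambda>x. (-\<i>) *s (B *v g x))) (to_L2 (slab \<alpha> 0 t))
      = z * cinner (to_L2 y) (to_L2 (slab \<alpha> 0 t))"
    and st: "0 \<le> s" "s \<le> t" "t \<le> m"
  shows "cinner (to_L2 y) (to_L2 (slab \<alpha> s t)) = 0"
proof -
  define Y where "Y i x = integral {0..x} (\<lambda>x. y x $ i)" for i x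
  define F where "F t = (\<Sum>i\<in>UNIV. \<alpha> i * y (charpt i t) $ i)" for t
  define G where "G t = (\<Sum>i\<in>UNIV. \<alpha> i * (of_real (\<beta> i) * (Y i (charpt i t) - Y i (charpt i 0))))" for t
  have sqy: "sq_integrable y" by (rule W12_deriv_sq_integrable[OF y])
  have sqg: "sq_integrable g" using y by (simp add: W12_deriv_def)
  have sqBg: "sq_integrable (\<lambda>x. (-\<i>) *s (B *v g x))"
    by (intro sq_integrable_scale sq_integrable_matrix_vector_mult sqg)
  have G: "cinner (to_L2 y) (to_L2 (slab \<alpha> 0 t)) = G t" if "t \<in> {0..m}" for t
    using that by (subst cinner_slab[OF sqy]) (auto simp: G_def Y_def)
  \<comment> \<open>The factor \<open>\<beta> i\<close> from \<open>cinner_slab\<close> cancels the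
    diagonal entry of \<open>B\<close>, so each term is the increment of \<open>y\<close> along its
    characteristic. The boundary relation says that \<open>F 0\<close> vanishes.\<close>
  have F: "cinner (to_L2 (\<lambda>x. (-\<i>) *s (B *v g x))) (to_L2 (slab \<alpha> 0 t)) = -\<i> * F t"
    if t: "t \<in> {0..m}" for t
  proof -
    have "of_real (\<beta> i) * (integral {0..charpt i t} (\<lambda>x. ((-\<i>) *s (B *v g x)) $ i) -
        integral {0..charpt i 0} (\<lambda>x. ((-\<i>) *s (B *v g x)) $ i)) =
        -\<i> * (y (charpt i t) $ i - y (charpt i 0) $ i)" for i
    proof -
      have "integral A (\<lambda>x. ((-\<i>) *s (B *v g x)) $ i) =
          -\<i> * of_real (inverse (\<beta> i)) * integral A (\<lambda>x. g x $ i)" for A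
        by (subst Henstock_Kurzweil_Integration.integral_mult_right[symmetric])
          (simp add: B mult.assoc)
      moreover have "y (charpt i t) $ i - y (charpt i 0) $ i =
          integral {0..charpt i t} (\<lambda>x. g x $ i) - integral {0..charpt i 0} (\<lambda>x. g x $ i)"
      proof -
        have "charpt i t \<in> {0..1}" "charpt i 0 \<in> {0..1}"
          using t m_pos by (intro charpt_mem; simp)+
        then show ?thesis
          using W12_deriv_component[OF y, of "charpt i t" i]
            W12_deriv_component[OF y, of "charpt i 0" i] by (metis add_diff_cancel_left)
      qed
      ultimately show ?thesis
        using \<beta>_nonzero[of i] by (simp only:) (simp add: field_simps)
    qed
    then have "cinner (to_L2 (\<lambda>x. (-\<i>) *s (B *v g x))) (to_L2 (slab \<alpha> 0 t)) =
        (\<Sum>i\<in>UNIV. \<alpha> i * (-\<i> * (y (charpt i t) $ i - y (charpt i 0) $ i)))"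
      using t by (subst cinner_slab[OF sqBg]) auto
    also have "\<dots> = -\<i> * (F t - F 0)"
      by (simp add: F_def sum_subtractf sum_distrib_left algebra_simps sum_negf)
    finally show ?thesis using bc by (simp add: F_def)
  qed
  have ode: "F t = \<i> * z * G t" if "t \<in> {0..m}" for t
  proof -
    have "-\<i> * F t = z * G t"
      using v[of t] F[OF that] G[OF that] that by simp
    then have "\<i> * (-\<i> * F t) = \<i> * (z * G t)" by (rule arg_cong)
    then show ?thesis by simp
  qed
  \<comment> \<open>The components of \<open>y\<close> are continuous, so their primitives are
    differentiable at every point, and the chain rule contributes the velocity.\<close>
  have dY: "((\<lambda>t. Y i (charpt i t)) has_vector_derivative inverse (\<beta> i) *\<^sub>R y (charpt i t) $ i)
      (at t within {0..m})" if t: "t \<in> {0..m}" for i t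
  proof -
    have "(charpt i has_vector_derivative inverse (\<beta> i)) (at t within {0..m})"
      unfolding charpt_def has_real_derivative_iff_has_vector_derivative[symmetric]
      by (auto intro!: derivative_eq_intros simp: field_simps \<beta>_nonzero)
    moreover have "(Y i has_vector_derivative y (charpt i t) $ i) (at (charpt i t) within charpt i ` {0..m})"
    proof (rule has_vector_derivative_within_subset)
      show "(Y i has_vector_derivative y (charpt i t) $ i) (at (charpt i t) within {0..1})"
        unfolding Y_def[abs_def]
        by (intro integral_has_vector_derivative W12_deriv_continuous[OF y] charpt_mem t)
    qed (use charpt_mem in auto)
    ultimately show ?thesis
      using vector_diff_chain_within[of "charpt i" _ t "{0..m}" "Y i"] by (simp add: o_def)
  qed
  have dG: "(G has_vector_derivative (\<i> * z) * G t) (at t within {0..m})" if t: "t \<in> {0..m}" for t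
  proof -
    have "(G has_vector_derivative (\<Sum>i\<in>UNIV. \<alpha> i * (of_real (\<beta> i) *
        (inverse (\<beta> i) *\<^sub>R y (charpt i t) $ i - 0)))) (at t within {0..m})"
      unfolding G_def[abs_def]
      by (intro has_vector_derivative_sum has_vector_derivative_mult_right
          has_vector_derivative_diff has_vector_derivative_const dY t)
    also have "(\<Sum>i\<in>UNIV. \<alpha> i * (of_real (\<beta> i) * (inverse (\<beta> i) *\<^sub>R y (charpt i t) $ i - 0))) = F t"
      unfolding F_def using \<beta>_nonzero
      by (intro sum.cong) (simp_all add: scaleR_conv_of_real field_simps)
    finally show ?thesis by (simp add: ode[OF t])
  qed
  have "G 0 = 0" by (simp add: G_def)
  then have "G t = 0" if "t \<in> {0..m}" for t
    using linear_ode_zero[of m G "\<i> * z" t] dG that by blast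
  then have "G t = 0" "G s = 0"
    using st by simp_all
  moreover have "cinner (to_L2 y) (to_L2 (slab \<alpha> s t)) = G t - G s"
    by (subst cinner_slab[OF sqy st])
      (simp add: G_def Y_def right_diff_distrib sum_subtractf)
  ultimately show ?thesis by simp
qed

end

section \<open>Linear algebra of the degenerate boundary conditions\<close>

lemma full_rank_rows_independent:
  fixes A :: "'a::field^'n^'m"
  assumes "rank A = CARD('m)" and sum: "(\<Sum>i\<in>UNIV. c i *s row i A) = 0"
  shows "c k = 0"
proof (rule ccontr)
  assume ck: "c k \<noteq> 0"
  let ?S = "(\<lambda>i. row i A) ` (UNIV - {k})"
  have "c k *s row k A = - (\<Sum>i\<in>UNIV - {k}. c i *s row i A)"
    using sum by (subst (asm) sum.remove[of _ k]) (auto simp: eq_neg_iff_add_eq_0)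
  also have "\<dots> \<in> vec.span ?S"
    by (intro vec.span_neg vec.span_sum vec.span_scale vec.span_base) auto
  finally have "inverse (c k) *s (c k *s row k A) \<in> vec.span ?S"
    by (rule vec.span_scale)
  then have "row k A \<in> vec.span ?S" using ck by simp
  then have "rows A \<subseteq> vec.span ?S"
    by (auto simp: rows_def intro: vec.span_base)
  then have "vec.dim (rows A) \<le> card ?S"
    by (intro vec.dim_le_card) auto
  also have "\<dots> \<le> CARD('m) - 1"
    by (rule order_trans[OF card_image_le]) auto
  finally show False
    using assms(1) zero_less_card_finite[where 'a = 'm] unfolding row_rank_def_gen by linarith
qed

lemma singular_left_kernel:
  fixes M :: "'a::field^'n^'n"
  assumes "det M = 0"
  obtains w where "w \<noteq> 0" "w v* M = 0"
proof -
  have "det (transpose M) = 0" using assms by simp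
  then have "\<not> (\<exists>N. N ** transpose M = mat 1)"
    using invertible_det_nz invertible_left_inverse by metis
  then obtain w where "w \<noteq> 0" "transpose M *v w = 0"
    unfolding matrix_left_invertible_ker by auto
  then show thesis using that by simp
qed

text \<open>The projectors are diagonal with entries 0 and 1. Hence a row vector \<open>w\<close> in
  the left kernel has \<open>w v* C\<close> zero where \<open>\<beta> i < 0\<close> and
  \<open>w v* D\<close> zero where \<open>\<beta> i > 0\<close>. Multiplying the boundary conditions
  by \<open>w\<close> leaves only the values at the starting points of the characteristics.\<close>

lemma degenerate_boundary_functional:
  fixes C D :: "complex^'n^'n" and \<beta> :: "'n::finite \<Rightarrow> real"
  assumes b: "\<And>i. b (blk i) = of_real (\<beta> i)" "\<And>i. \<beta> i \<noteq> 0"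
    and "B = block_diag blk (\<lambda>j. inverse (b j))"
    and rank: "rank (hcat C D) = CARD('n)"
    and det: "det (C ** proj_neg B + D ** proj_pos B) = 0"
  obtains \<alpha> k where "\<alpha> k \<noteq> 0"
    "\<And>u v. C *v u + D *v v = 0 \<Longrightarrow> (\<Sum>i\<in>UNIV. \<alpha> i * (if \<beta> i > 0 then u $ i else v $ i)) = 0"
proof -
  obtain w where w: "w \<noteq> 0" "w v* (C ** proj_neg B + D ** proj_pos B) = 0"
    using singular_left_kernel[OF det] .
  have mem: "inverse (b (blk i)) \<in> complex_of_real ` {0<..} \<longleftrightarrow> \<beta> i > 0"
    "inverse (b (blk i)) \<in> complex_of_real ` {..<0} \<longleftrightarrow> \<beta> i < 0" for i
    by (auto simp: b(1) of_real_inverse[symmetric] simp del: of_real_inverse)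
  have diag: "(w v* block_diag blk d) $ i = w $ i * d (blk i)" for w :: "complex^'n" and d i
    by (simp add: vector_matrix_mult_def block_diag_def if_distrib mult.commute cong: if_cong)
  have ker: "(w v* C) $ i * (if \<beta> i < 0 then 1 else 0) + (w v* D) $ i * (if \<beta> i > 0 then 1 else 0) = 0" for i
  proof -
    have "(w v* (C ** proj_neg B + D ** proj_pos B)) $ i = 0" using w by simp
    then show ?thesis
      unfolding proj_neg_def proj_pos_def assms(3) spectral_projector_block_diag
      by (simp add: vector_matrix_mult_add_rdistrib vector_matrix_mul_assoc[symmetric] diag mem cong: if_cong)
  qed
  have kerC: "(w v* C) $ i = 0" if "\<beta> i < 0" for i using ker[of i] that by simp
  have kerD: "(w v* D) $ i = 0" if "\<beta> i > 0" for i using ker[of i] that by simp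
  define \<alpha> where "\<alpha> i = (if \<beta> i > 0 then (w v* C) $ i else (w v* D) $ i)" for i
  \<comment> \<open>Otherwise \<open>w\<close> would annihilate both \<open>C\<close> and
    \<open>D\<close>, a nontrivial relation between the rows of \<open>hcat C D\<close>, against the
    rank condition.\<close>
  have "\<exists>k. \<alpha> k \<noteq> 0"
  proof (rule ccontr)
    assume "\<nexists>k. \<alpha> k \<noteq> 0"
    then have "(w v* C) $ i = 0 \<and> (w v* D) $ i = 0" for i
      using kerC[of i] kerD[of i] b(2)[of i] unfolding \<alpha>_def by (metis linorder_neqE_linordered_idom)
    then have "(\<Sum>i\<in>UNIV. w $ i *s row i (hcat C D)) $ j = 0" for j
      by (cases j) (auto simp: row_def hcat_def vector_matrix_mult_def mult.commute)
    then have "(\<Sum>i\<in>UNIV. w $ i *s row i (hcat C D)) = 0"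
      by (simp add: vec_eq_iff del: sum_component)
    then have "w = 0"
      using full_rank_rows_independent[OF rank] by (auto simp: vec_eq_iff)
    with w show False by simp
  qed
  then obtain k where "\<alpha> k \<noteq> 0" by blast
  moreover have "(\<Sum>i\<in>UNIV. \<alpha> i * (if \<beta> i > 0 then u $ i else v $ i)) = 0"
    if "C *v u + D *v v = 0" for u v
  proof -
    have dot: "(\<Sum>i\<in>UNIV. (w v* A) $ i * x $ i) = (\<Sum>j\<in>UNIV. w $ j * (A *v x) $ j)"
      for A :: "complex^'n^'n" and x
      unfolding vector_matrix_mult_def matrix_vector_mult_def
      by (simp add: sum_distrib_left sum_distrib_right) (subst sum.swap, simp add: mult_ac)
    have "(\<Sum>i\<in>UNIV. \<alpha> i * (if \<beta> i > 0 then u $ i else v $ i)) =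
        (\<Sum>i\<in>UNIV. (w v* C) $ i * u $ i + (w v* D) $ i * v $ i)"
      by (rule sum.cong) (use kerC kerD b(2) in \<open>auto simp: \<alpha>_def not_less order.order_iff_strict\<close>)
    also have "\<dots> = (\<Sum>j\<in>UNIV. w $ j * (C *v u + D *v v) $ j)"
      by (simp add: sum.distrib dot distrib_left)
    finally show ?thesis using that by simp
  qed
  ultimately show thesis by (rule that)
qed

section \<open>Root functions and the theorem\<close>

lemma (in characteristics) root_vector_orthogonal_slab:
  assumes blk: "\<And>v i. (B *v v) $ i = of_real (inverse (\<beta> i)) * v $ i"
    and \<alpha>: "\<And>u v. C *v u + D *v v = 0 \<Longrightarrow> (\<Sum>i\<in>UNIV. \<alpha> i * (if \<beta> i > 0 then u $ i else v $ i)) = 0"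
    and "(u, 0) \<in> shift_op (bvp_op B C D) z ^^ k"
    and "0 \<le> s" "s \<le> t" "t \<le> m"
  shows "cinner u (to_L2 (slab \<alpha> s t)) = 0"
  using assms(3-)
\<comment> \<open>Splitting off the first factor of the relational power gives v = (L - z)u,
  annihilated by \<open>k\<close> further applications. The slab must be arbitrary, because the step
  needs \<open>v\<close> orthogonal to \<open>slab \<alpha> 0 t\<close> for every \<open>t\<close>
  up to \<open>m\<close>.\<close>
proof (induction k arbitrary: u s t)
  case 0
  then show ?case by simp
next
  case (Suc k)
  then obtain v where uv: "(u, v) \<in> shift_op (bvp_op B C D) z"
    and v: "(v, 0) \<in> shift_op (bvp_op B C D) z ^^ k"
    by (meson relpow_Suc_D2)
  from uv obtain y g where y: "W12_deriv y g" "C *v y 0 + D *v y 1 = 0" "u = to_L2 y"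
    and veq: "v = to_L2 (\<lambda>x. (-\<i>) *s (B *v g x)) - scaleC z (to_L2 y)"
    unfolding shift_op_def bvp_op_def by blast
  have "y (charpt i 0) $ i = (if \<beta> i > 0 then y 0 $ i else y 1 $ i)" for i
    by (simp add: charpt_def)
  then have "(\<Sum>i\<in>UNIV. \<alpha> i * y (charpt i 0) $ i) = 0"
    using \<alpha>[OF y(2)] by simp
  then show ?case
    unfolding y(3)
  proof (rule cinner_slab_solution[OF y(1) _ blk])
    fix t assume "0 \<le> t" "t \<le> m"
    then have "cinner v (to_L2 (slab \<alpha> 0 t)) = 0"
      using Suc.IH[OF v] by simp
    then show "cinner (to_L2 (\<lambda>x. (-\<i>) *s (B *v g x))) (to_L2 (slab \<alpha> 0 t)) =
        z * cinner (to_L2 y) (to_L2 (slab \<alpha> 0 t))"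
      by (simp add: veq cinner_diff_left cinner_scaleC_left)
  qed (use Suc.prems in auto)
qed

theorem proposition4p6:
  fixes b :: "'r::finite \<Rightarrow> complex"
    and blk :: "'n::finite \<Rightarrow> 'r"
    and B C D :: "complex^'n^'n"
    and E :: "'n L2 set"
  assumes "\<And>j. b j \<noteq> 0"
    and "inj b"
    and "surj blk"
    and "B = block_diag blk (\<lambda>j. inverse (b j))"
    and "B = adjoint_matrix B"
    and "rank (hcat C D) = CARD('n)"
    and "det (C ** proj_neg B + D ** proj_pos B) = 0"
    and "root_function_system (bvp_op B C D) E"
  shows "\<not> complete_system E \<and> defect E = \<infinity>"
proof -
  define \<beta> where "\<beta> i = Re (b (blk i))" for i
  have b_real: "b (blk i) = of_real (\<beta> i)" for i
  proof -
    have "B $ i $ i = adjoint_matrix B $ i $ i" using assms(5) by (rule arg_cong)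
    then have "inverse (b (blk i)) = cnj (inverse (b (blk i)))"
      by (simp add: assms(4) adjoint_matrix_def block_diag_def)
    then have "b (blk i) = cnj (b (blk i))"
      by (metis complex_cnj_inverse inverse_inverse_eq)
    then show ?thesis by (simp add: \<beta>_def complex_eq_iff)
  qed
  have \<beta>_nz: "\<beta> i \<noteq> 0" for i
    using assms(1)[of "blk i"] b_real[of i] by auto
  obtain \<alpha> k where \<alpha>: "\<alpha> k \<noteq> 0"
    "\<And>u v. C *v u + D *v v = 0 \<Longrightarrow> (\<Sum>i\<in>UNIV. \<alpha> i * (if \<beta> i > 0 then u $ i else v $ i)) = 0"
    using degenerate_boundary_functional[OF b_real \<beta>_nz assms(4,6,7)] by blast
  \<comment> \<open>The time at which the fastest characteristic reaches the opposite end; it is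
    positive because the index type is finite.\<close>
  define m where "m = Min (range (\<lambda>i. \<bar>\<beta> i\<bar>))"
  interpret characteristics \<beta> m
    using \<beta>_nz by unfold_locales (auto simp: m_def)
  have B: "(B *v v) $ i = of_real (inverse (\<beta> i)) * v $ i" for v i
    by (simp add: assms(4) block_diag_mult_vec b_real)
  have orth: "to_L2 (slab \<alpha> s t) \<in> orth_complement (closure (L2.span E))"
    if st: "0 \<le> s" "s \<le> t" "t \<le> m" for s t
  proof (rule orth_complement_closure_span)
    fix u assume "u \<in> E"
    then obtain z where "u \<in> root_subspace (bvp_op B C D) z"
      using assms(8) unfolding root_function_system_def is_basis_def by blast
    moreover have "root_subspace (bvp_op B C D) z \<subseteq> {u. cinner u (to_L2 (slab \<alpha> s t)) = 0}"
      unfolding root_subspace_def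
      by (intro L2.span_minimal subspace_cinner_zero)
        (use root_vector_orthogonal_slab[OF B \<alpha>(2) _ st] in auto)
    ultimately show "cinner u (to_L2 (slab \<alpha> s t)) = 0" by blast
  qed
  obtain S where S: "infinite S" "L2.independent S"
    "\<And>h. h \<in> S \<Longrightarrow> \<exists>s t. 0 \<le> s \<and> s \<le> t \<and> t \<le> m \<and> h = to_L2 (slab \<alpha> s t)"
    using infinite_orthogonal_slabs[of \<alpha> k, OF \<alpha>(1)] by blast
  have "S \<subseteq> orth_complement (closure (L2.span E))"
    using S(3) orth by blast
  then have "defect E = \<infinity>"
    unfolding defect_def by (rule subspace_dim_infinite[OF S(1,2)])
  moreover have "\<not> complete_system E"
  proof
    assume "complete_system E"
    \<comment> \<open>Completeness would make this slab orthogonal to itself, although it is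
      nonzero.\<close>
    then have "to_L2 (slab \<alpha> 0 m) \<in> orth_complement UNIV"
      using orth[of 0 m] m_pos by (simp add: complete_system_def)
    then have "to_L2 (slab \<alpha> 0 m) = 0"
      by (intro cinner_self_eq_0) (auto simp: orth_complement_def)
    then show False
      using slab_nonzero[of \<alpha> k 0 m, OF \<alpha>(1)] m_pos by simp
  qed
  ultimately show ?thesis by blast
qed

end
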